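(* Let $p>0$, $Y=[0,\infty]$, and let $\circ\colon Y^2\to Y$ be a nondecreasing operator such that $x\circ(y+z)\le(x\circ y)+(x\circ z)$ and $(ax)\circ y\le a^p(x\circ y)$ for all $x,y,z\in Y$ and $a>1$. Let $\mu$ be a subadditive measure on a measurable space $(X,\mathcal{A})$. If $f_n,f\in L^p_\circ$ for all $n\in\mathbb{N}$ and $\lim_{n\to\infty}d_{\circ,p}(f_n,f)=0$, then $$\int_{\circ,X}|f_n|^p\,d\mu\to\int_{\circ,X}|f|^p\,d\mu\quad\text{as }n\to\infty.$$
   Context: A subadditive measure is a nondecreasing set function $\mu\colon\mathcal{A}\to[0,\infty]$ with $\mu(\emptyset)=0$ and $\mu(A\cup B)\le\mu(A)+\mu(B)$ for all $A,B\in\mathcal{A}$ (no continuity of $\mu$ is assumed). An operator $\circ$ is nondecreasing if $a\circ b\le x\circ y$ whenever $a\le x$, $b\le y$. For measurable $h\colon X\to Y$, $\int_{\circ,X}h\,d\mu:=\sup_{t\in Y}\{t\circ\mu(\{h\ge t\})\}$. For measurable $f,g\colon X\to\mathbb{R}$, $d_{\circ,p}(f,g)=\big(\int_{\circ,X}|f-g|^p\,d\mu\big)^{1/(p^2+1)}$, and $f\in L^p_\circ$ means that $f\colon X\to\mathbb{R}$ is measurable with $d_{\circ,p}(f,0)<\infty$ (functions with $\mu(\{|f-g|>0\})=0$ being identified, which does not affect the integrals). *)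

theory Defs
  imports "HOL-Analysis.Analysis"
begin

text \<open>
  The interval \<open>[0, \<infinity>]\<close> is the type \<^typ>\<open>ennreal\<close>, where
  \<open>\<infinity> * 0 = 0\<close>. A value of type \<^typ>\<open>'a measure\<close> serves
  only as a measurable space; the set function \<open>\<mu>\<close> is a separate argument, and only its
  values on \<^term>\<open>sets M\<close> matter.
\<close>

text \<open>Unlike the library's \<open>subadditive\<close>, the sets \<open>A\<close> and \<open>B\<close> need not be disjoint.\<close>

definition subadditive_measure :: "'a measure \<Rightarrow> ('a set \<Rightarrow> ennreal) \<Rightarrow> bool" where
  "subadditive_measure M \<mu> \<longleftrightarrow>
     positive (sets M) \<mu> \<and> increasing (sets M) \<mu> \<and>
     (\<forall>A\<in>sets M. \<forall>B\<in>sets M. \<mu> (A \<union> B) \<le> \<mu> A + \<mu> B)"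

definition nondecreasing_op :: "(ennreal \<Rightarrow> ennreal \<Rightarrow> ennreal) \<Rightarrow> bool" where
  "nondecreasing_op opr \<longleftrightarrow> (\<forall>a b x y. a \<le> x \<longrightarrow> b \<le> y \<longrightarrow> opr a b \<le> opr x y)"

text \<open>The supremum includes the levels \<open>t = 0\<close> and \<open>t = \<infinity>\<close>.\<close>

definition op_integral ::
  "(ennreal \<Rightarrow> ennreal \<Rightarrow> ennreal) \<Rightarrow> 'a measure \<Rightarrow> ('a set \<Rightarrow> ennreal) \<Rightarrow> ('a \<Rightarrow> ennreal) \<Rightarrow> ennreal"
where
  "op_integral opr M \<mu> h = (SUP t. opr t (\<mu> {x\<in>space M. t \<le> h x}))"

text \<open>Real powers on \<open>[0, \<infinity>]\<close>, intended for positive exponents only.\<close>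

definition ennpowr :: "ennreal \<Rightarrow> real \<Rightarrow> ennreal" where
  "ennpowr x r = (if x = \<infinity> then \<infinity> else ennreal (enn2real x powr r))"

definition op_dist ::
  "(ennreal \<Rightarrow> ennreal \<Rightarrow> ennreal) \<Rightarrow> real \<Rightarrow> 'a measure \<Rightarrow> ('a set \<Rightarrow> ennreal)
     \<Rightarrow> ('a \<Rightarrow> real) \<Rightarrow> ('a \<Rightarrow> real) \<Rightarrow> ennreal"
where
  "op_dist opr p M \<mu> f g =
     ennpowr (op_integral opr M \<mu> (\<lambda>x. ennreal (\<bar>f x - g x\<bar> powr p))) (1 / (p\<^sup>2 + 1))"

text \<open>The elements are functions rather than classes of functions that agree up to a
  \<open>\<mu>\<close>-null set; by the lemma below the integrals depend on the class only.\<close>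

definition op_Lp ::
  "(ennreal \<Rightarrow> ennreal \<Rightarrow> ennreal) \<Rightarrow> real \<Rightarrow> 'a measure \<Rightarrow> ('a set \<Rightarrow> ennreal) \<Rightarrow> ('a \<Rightarrow> real) set"
where
  "op_Lp opr p M \<mu> = {f \<in> borel_measurable M. op_dist opr p M \<mu> f (\<lambda>x. 0) < \<infinity>}"

lemma op_integral_cong_null:
  fixes f g :: "'a \<Rightarrow> real"
  assumes mu: "subadditive_measure M \<mu>"
    and [measurable]: "f \<in> borel_measurable M" "g \<in> borel_measurable M"
    and null: "\<mu> {x\<in>space M. \<bar>f x - g x\<bar> > 0} = 0"
  shows "op_integral opr M \<mu> (\<lambda>x. ennreal (\<bar>f x\<bar> powr p))
       = op_integral opr M \<mu> (\<lambda>x. ennreal (\<bar>g x\<bar> powr p))"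
proof -
  have le: "\<mu> {x\<in>space M. t \<le> ennreal (\<bar>u x\<bar> powr p)} \<le> \<mu> {x\<in>space M. t \<le> ennreal (\<bar>v x\<bar> powr p)}"
    if [measurable]: "u \<in> borel_measurable M" "v \<in> borel_measurable M"
      and uv: "\<mu> {x\<in>space M. \<bar>u x - v x\<bar> > 0} = 0" for u v :: "'a \<Rightarrow> real" and t
  proof -
    let ?A = "{x\<in>space M. t \<le> ennreal (\<bar>u x\<bar> powr p)}"
    let ?B = "{x\<in>space M. t \<le> ennreal (\<bar>v x\<bar> powr p)}"
    let ?N = "{x\<in>space M. \<bar>u x - v x\<bar> > 0}"
    have S: "?A \<in> sets M" "?B \<in> sets M" "?N \<in> sets M" by measurable
    have "?A \<subseteq> ?B \<union> ?N" by auto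
    then have "\<mu> ?A \<le> \<mu> (?B \<union> ?N)"
      using mu S by (auto simp: subadditive_measure_def increasing_def)
    also have "\<dots> \<le> \<mu> ?B + \<mu> ?N"
      using mu S by (auto simp: subadditive_measure_def)
    finally show ?thesis using uv by simp
  qed
  have "\<mu> {x\<in>space M. t \<le> ennreal (\<bar>f x\<bar> powr p)} = \<mu> {x\<in>space M. t \<le> ennreal (\<bar>g x\<bar> powr p)}" for t
    using null by (intro antisym le) (auto simp: abs_minus_commute)
  then show ?thesis by (simp add: op_integral_def)
qed

end

theory Submission
  imports Defs
begin

text \<open>
  If \<open>\<bar>u + v\<bar>\<^sup>p \<ge> t\<close> and \<open>0 < l < 1\<close>, then \<open>\<bar>u\<bar>\<^sup>p \<ge> l\<^sup>p t\<close> or \<open>\<bar>v\<bar>\<^sup>p \<ge> (1 - l)\<^sup>p t\<close>.  Hence, writing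
  \<open>I(u)\<close> for the integral of \<open>\<bar>u\<bar>\<^sup>p\<close>, the hypotheses on the operator yield the weighted triangle
  inequality \<open>I(u + v) \<le> l\<^sup>-\<^sup>q I(u) + (1 - l)\<^sup>-\<^sup>q I(v)\<close> with \<open>q = p\<^sup>2\<close>.  Applied to \<open>f\<^sub>n = f + (f\<^sub>n - f)\<close> and
  \<open>f = f\<^sub>n + (f - f\<^sub>n)\<close>, where \<open>I(f\<^sub>n - f) \<rightarrow> 0\<close>, it traps the upper and the lower limit of \<open>I(f\<^sub>n)\<close>
  between \<open>l\<^sup>q I(f)\<close> and \<open>l\<^sup>-\<^sup>q I(f)\<close>; finally \<open>l \<rightarrow> 1\<close>.
\<close>

text \<open>The lowered level \<open>s = l powr p * t\<close> is itself one of the levels in the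
  supremum, and \<open>t\<close> is \<open>s\<close> scaled up by \<open>l powr (-p) > 1\<close>.
  The homogeneity hypothesis raises this factor to the power \<open>p\<close>, whence the exponent
  \<open>- p\<^sup>2\<close>.\<close>

lemma op_scaled_level_le:
  fixes opr :: "ennreal \<Rightarrow> ennreal \<Rightarrow> ennreal" and h :: "'a \<Rightarrow> ennreal"
  assumes hom: "\<And>(a::real) x y. a > 1 \<Longrightarrow> opr (ennreal a * x) y \<le> ennreal (a powr p) * opr x y"
    and p: "p > 0" and l: "0 < l" "l < 1"
  shows "opr t (\<mu> {x\<in>space M. ennreal (l powr p) * t \<le> h x})
           \<le> ennreal (l powr - p\<^sup>2) * op_integral opr M \<mu> h"
proof -
  let ?s = "ennreal (l powr p) * t"
  let ?A = "{x\<in>space M. ?s \<le> h x}"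
  have "l powr (-p) > 1"
    using powr_less_mono2_neg[of "- p" l 1] p l by simp
  note hom = hom[OF this, of ?s "\<mu> ?A"]
  have "ennreal (l powr (-p)) * ?s = t"
    using l by (simp add: mult.assoc[symmetric] ennreal_mult'[symmetric] powr_add[symmetric])
  moreover have "(l powr (-p)) powr p = l powr - p\<^sup>2"
    by (simp add: powr_powr power2_eq_square)
  ultimately have "opr t (\<mu> ?A) \<le> ennreal (l powr - p\<^sup>2) * opr ?s (\<mu> ?A)"
    using hom by simp
  also have "\<dots> \<le> ennreal (l powr - p\<^sup>2) * op_integral opr M \<mu> h"
    unfolding op_integral_def by (intro mult_left_mono SUP_upper) auto
  finally show ?thesis .
qed

text \<open>Splitting \<open>\<bar>a + b\<bar>\<close> into the shares \<open>l\<close> and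
  \<open>1 - l\<close>, the triangle inequality forces \<open>\<bar>a\<bar>\<close> or
  \<open>\<bar>b\<bar>\<close> to reach its share.\<close>

lemma level_le_split:
  fixes a b :: real and t :: ennreal
  assumes p: "p > 0" and l: "0 < l" "l < 1"
    and t: "t \<le> ennreal (\<bar>a + b\<bar> powr p)"
  shows "ennreal (l powr p) * t \<le> ennreal (\<bar>a\<bar> powr p) \<or>
         ennreal ((1 - l) powr p) * t \<le> ennreal (\<bar>b\<bar> powr p)"
proof -
  have scaled: "ennreal (k powr p) * t \<le> ennreal (c powr p)"
    if "0 < k" "k * \<bar>a + b\<bar> \<le> c" for k c
  proof -
    have "ennreal (k powr p) * t \<le> ennreal (k powr p) * ennreal (\<bar>a + b\<bar> powr p)"
      using t by (rule mult_left_mono) simp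
    also have "\<dots> = ennreal ((k * \<bar>a + b\<bar>) powr p)"
      using that by (simp add: ennreal_mult'[symmetric] powr_mult)
    also have "\<dots> \<le> ennreal (c powr p)"
      using that p by (intro ennreal_leI powr_mono2) auto
    finally show ?thesis .
  qed
  have "l * \<bar>a + b\<bar> + (1 - l) * \<bar>a + b\<bar> = \<bar>a + b\<bar>"
    by (simp add: algebra_simps)
  then have "l * \<bar>a + b\<bar> \<le> \<bar>a\<bar> \<or> (1 - l) * \<bar>a + b\<bar> \<le> \<bar>b\<bar>"
    by linarith
  then show ?thesis
    using scaled[of l "\<bar>a\<bar>"] scaled[of "1 - l" "\<bar>b\<bar>"] l by auto
qed

text \<open>At each level \<open>t\<close> two superlevel sets at lowered levels cover that of the
  sum. Subadditivity of \<open>\<mu>\<close>, then of \<open>opr\<close> in its second argument,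
  turns the cover into two terms, each with a bound free of \<open>t\<close>.\<close>

lemma op_integral_triangle:
  fixes u v :: "'a \<Rightarrow> real"
  assumes mono: "nondecreasing_op opr"
    and add: "\<And>x y z. opr x (y + z) \<le> opr x y + opr x z"
    and hom: "\<And>(a::real) x y. a > 1 \<Longrightarrow> opr (ennreal a * x) y \<le> ennreal (a powr p) * opr x y"
    and mu: "subadditive_measure M \<mu>"
    and [measurable]: "u \<in> borel_measurable M" "v \<in> borel_measurable M"
    and p: "p > 0" and l: "0 < l" "l < 1"
  shows "op_integral opr M \<mu> (\<lambda>x. ennreal (\<bar>u x + v x\<bar> powr p))
    \<le> ennreal (l powr - p\<^sup>2) * op_integral opr M \<mu> (\<lambda>x. ennreal (\<bar>u x\<bar> powr p))
      + ennreal ((1 - l) powr - p\<^sup>2) * op_integral opr M \<mu> (\<lambda>x. ennreal (\<bar>v x\<bar> powr p))"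
    (is "?I \<le> ?R")
  unfolding op_integral_def[of _ _ _ "\<lambda>x. ennreal (\<bar>u x + v x\<bar> powr p)"]
proof (rule SUP_least)
  fix t :: ennreal
  let ?S = "{x\<in>space M. t \<le> ennreal (\<bar>u x + v x\<bar> powr p)}"
  let ?A = "{x\<in>space M. ennreal (l powr p) * t \<le> ennreal (\<bar>u x\<bar> powr p)}"
  let ?B = "{x\<in>space M. ennreal ((1 - l) powr p) * t \<le> ennreal (\<bar>v x\<bar> powr p)}"
  have S: "?S \<in> sets M" "?A \<in> sets M" "?B \<in> sets M" by measurable
  have "?S \<subseteq> ?A \<union> ?B"
    using level_le_split[OF p l] by blast
  then have "\<mu> ?S \<le> \<mu> (?A \<union> ?B)"
    using mu S by (auto simp: subadditive_measure_def increasing_def)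
  also have "\<dots> \<le> \<mu> ?A + \<mu> ?B"
    using mu S by (auto simp: subadditive_measure_def)
  finally have "opr t (\<mu> ?S) \<le> opr t (\<mu> ?A + \<mu> ?B)"
    using mono by (auto simp: nondecreasing_op_def)
  also have "\<dots> \<le> opr t (\<mu> ?A) + opr t (\<mu> ?B)"
    by (rule add)
  also have "\<dots> \<le> ?R"
    using l by (intro add_mono op_scaled_level_le[OF hom p]) auto
  finally show "opr t (\<mu> ?S) \<le> ?R" .
qed

text \<open>This strips the outer exponent \<open>1 / (p\<^sup>2 + 1)\<close> from the
  distance.\<close>

lemma tendsto_0_if_ennpowr_tendsto_0:
  assumes r: "r > 0" and lim: "((\<lambda>n. ennpowr (X n) r) \<longlongrightarrow> 0) F"
  shows "(X \<longlongrightarrow> 0) F"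
proof (rule order_tendstoI)
  fix e :: ennreal assume "0 < e"
  \<comment> \<open>As \<open>e\<close> may be infinite, a finite radius \<open>d\<close> below it
    is chosen first.\<close>
  then obtain c where "0 < c" "c < e"
    using dense by blast
  then obtain d where d: "0 < d" "ennreal d < e"
    by (cases c) auto
  have "\<forall>\<^sub>F n in F. ennpowr (X n) r < ennreal (d powr r)"
    using d by (intro order_tendstoD(2)[OF lim]) auto
  then show "\<forall>\<^sub>F n in F. X n < e"
  proof eventually_elim
    case (elim n)
    \<comment> \<open>Infinity must be excluded explicitly, since \<open>enn2real\<close> sends it
      to 0.\<close>
    then have "X n \<noteq> \<infinity>" and "enn2real (X n) powr r < d powr r"
      by (auto simp: ennpowr_def ennreal_less_iff split: if_splits)
    then have "enn2real (X n) < d"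
      using r d by (meson less_imp_le not_le powr_mono2)
    then have "X n < ennreal d"
      using \<open>X n \<noteq> \<infinity>\<close> by (cases "X n") (auto simp: ennreal_less_iff)
    then show ?case using d by simp
  qed
qed auto

theorem theorem7:
  fixes p :: real
    and opr :: "ennreal \<Rightarrow> ennreal \<Rightarrow> ennreal"
    and M :: "'a measure"
    and \<mu> :: "'a set \<Rightarrow> ennreal"
    and f :: "'a \<Rightarrow> real"
    and fn :: "nat \<Rightarrow> 'a \<Rightarrow> real"
  assumes "p > 0"
    and "nondecreasing_op opr"
    and "\<And>x y z. opr x (y + z) \<le> opr x y + opr x z"
    and "\<And>(a::real) x y. a > 1 \<Longrightarrow> opr (ennreal a * x) y \<le> ennreal (a powr p) * opr x y"
    and "subadditive_measure M \<mu>"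
    and "\<And>n. fn n \<in> op_Lp opr p M \<mu>"
    and "f \<in> op_Lp opr p M \<mu>"
    and "(\<lambda>n. op_dist opr p M \<mu> (fn n) f) \<longlonglongrightarrow> 0"
  shows "(\<lambda>n. op_integral opr M \<mu> (\<lambda>x. ennreal (\<bar>fn n x\<bar> powr p)))
           \<longlonglongrightarrow> op_integral opr M \<mu> (\<lambda>x. ennreal (\<bar>f x\<bar> powr p))"
proof -
  define I where "I u = op_integral opr M \<mu> (\<lambda>x. ennreal (\<bar>u x\<bar> powr p))" for u :: "'a \<Rightarrow> real"
  define J where "J n = I (\<lambda>x. fn n x - f x)" for n
  note triangle = op_integral_triangle[OF assms(2-5) _ _ \<open>p > 0\<close>, folded I_def]
  have meas [measurable]: "fn n \<in> borel_measurable M" "f \<in> borel_measurable M" for n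
    using assms(6,7) by (auto simp: op_Lp_def)
  have fin: "I f \<noteq> \<infinity>"
    using assms(7) by (auto simp: op_Lp_def op_dist_def I_def ennpowr_def)
  have "0 < 1 / (p\<^sup>2 + 1)"
    by (simp add: add_nonneg_pos)
  then have J: "J \<longlonglongrightarrow> 0"
    using assms(8) unfolding op_dist_def J_def I_def by (rule tendsto_0_if_ennpowr_tendsto_0)

  have upper: "Limsup sequentially (\<lambda>n. I (fn n)) \<le> ennreal (l powr - p\<^sup>2) * I f"
    if l: "0 < l" "l < 1" for l
  proof -
    let ?c = "ennreal (l powr - p\<^sup>2)" and ?d = "ennreal ((1 - l) powr - p\<^sup>2)"
    \<comment> \<open>The number \<open>l\<close> stays fixed while \<open>n\<close> grows, so
      \<open>?d\<close>, although it blows up as \<open>l\<close> tends to 1, is a finite factor and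
      \<open>?d * J n\<close> vanishes in the limit.\<close>
    have "I (fn n) \<le> ?c * I f + ?d * J n" for n
      using triangle[of f "\<lambda>x. fn n x - f x" l] l by (simp add: J_def)
    then have "Limsup sequentially (\<lambda>n. I (fn n)) \<le> Limsup sequentially (\<lambda>n. ?c * I f + ?d * J n)"
      by (intro Limsup_mono) simp
    also have "(\<lambda>n. ?c * I f + ?d * J n) \<longlonglongrightarrow> ?c * I f + ?d * 0"
      by (intro tendsto_add tendsto_const ennreal_tendsto_cmult J) simp
    then have "Limsup sequentially (\<lambda>n. ?c * I f + ?d * J n) = ?c * I f"
      by (simp add: lim_imp_Limsup)
    finally show ?thesis .
  qed
  have lower: "ennreal (l powr p\<^sup>2) * I f \<le> Liminf sequentially (\<lambda>n. I (fn n))"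
    if l: "0 < l" "l < 1" for l
  proof -
    let ?c = "ennreal (l powr p\<^sup>2)" and ?d = "ennreal ((1 - l) powr - p\<^sup>2)"
    \<comment> \<open>The difference is truncated at 0, and \<open>?c\<close> is the inverse of the
      weight of \<open>I (fn n)\<close> in the triangle inequality.\<close>
    have le: "?c * (I f - ?d * J n) \<le> I (fn n)" for n
    proof -
      have "I (\<lambda>x. f x - fn n x) = J n"
        by (simp add: J_def I_def abs_minus_commute)
      then have "I f \<le> ?d * J n + ennreal (l powr - p\<^sup>2) * I (fn n)"
        using triangle[of "fn n" "\<lambda>x. f x - fn n x" l] l by (simp add: add.commute)
      then have "?c * (I f - ?d * J n) \<le> ?c * (ennreal (l powr - p\<^sup>2) * I (fn n))"
        using fin by (intro mult_left_mono ennreal_minus_le_iff[THEN iffD2]) auto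
      also have "\<dots> = I (fn n)"
        using l by (simp add: mult.assoc[symmetric] ennreal_mult'[symmetric] powr_add[symmetric])
      finally show ?thesis .
    qed
    have "(\<lambda>n. ?c * (I f - ?d * J n)) \<longlonglongrightarrow> ?c * (I f - ?d * 0)"
      using fin by (intro ennreal_tendsto_cmult tendsto_diff_ennreal tendsto_const J) auto
    then have "?c * I f = Liminf sequentially (\<lambda>n. ?c * (I f - ?d * J n))"
      by (simp add: lim_imp_Liminf)
    also have "\<dots> \<le> Liminf sequentially (\<lambda>n. I (fn n))"
      by (intro Liminf_mono) (simp add: le)
    finally show ?thesis .
  qed

  have ev: "\<forall>\<^sub>F l in at_left (1::real). 0 < l \<and> l < 1"
    using eventually_at_left_real[of 0 1] by simp
  \<comment> \<open>Used with \<open>q = - p\<^sup>2\<close> for the upper and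
    \<open>q = p\<^sup>2\<close> for the lower bound; multiplication by \<open>I f\<close> is
    continuous because \<open>I f\<close> is finite.\<close>
  have scale: "((\<lambda>l. ennreal (l powr q) * I f) \<longlongrightarrow> I f) (at_left 1)" for q
  proof -
    have "((\<lambda>l::real. l powr q) \<longlongrightarrow> 1 powr q) (at_left 1)"
      by (intro tendsto_intros) simp
    then have "((\<lambda>l. I f * ennreal (l powr q)) \<longlongrightarrow> I f * ennreal (1 powr q)) (at_left 1)"
      using fin by (intro ennreal_tendsto_cmult tendsto_ennrealI) (auto simp: less_top)
    then show ?thesis by (simp add: mult.commute)
  qed
  have "Limsup sequentially (\<lambda>n. I (fn n)) \<le> I f"
    by (rule tendsto_lowerbound[OF scale]) (use ev in eventually_elim, use upper in auto)
  moreover have "I f \<le> Liminf sequentially (\<lambda>n. I (fn n))"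
    by (rule tendsto_upperbound[OF scale]) (use ev in eventually_elim, use lower in auto)
  moreover have "Liminf sequentially (\<lambda>n. I (fn n)) \<le> Limsup sequentially (\<lambda>n. I (fn n))"
    by (rule Liminf_le_Limsup) simp
  ultimately have "(\<lambda>n. I (fn n)) \<longlonglongrightarrow> I f"
    by (intro Liminf_eq_Limsup) auto
  then show ?thesis by (simp add: I_def)
qed

end
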